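(* Positivity of the magnetic curvature is not necessary for an energy level to be of contact type: there exist a Riemannian metric $g$ on the oriented sphere $S^2$ with area form $\mu$, a symplectic form $\sigma=f\mu$ with $f>0$ and $\int_{S^2}\sigma=4\pi$, and a number $m>0$, such that the energy level $\Sigma_{\frac12m^2}$ of the magnetic system $(S^2,g,\sigma)$ is of contact type but the condition $K_m>0$ (everywhere on $SS^2$) fails.
   Context: Let $\pi:TS^2\to S^2$ be the tangent bundle, $\alpha_{(x,v)}(\xi)=g_x(v,d\pi\,\xi)$, $E(x,v)=\frac12g_x(v,v)$, $\Sigma_c=\{E=c\}$. The level $\Sigma_c$ ($c>0$) is of contact type if $(d\alpha-\pi^*\sigma)|_{\Sigma_c}$ has a primitive which is a contact form on $\Sigma_c$. With $\jmath$ the rotation by $\pi/2$ and $K$ the Gaussian curvature, the magnetic curvature $K_m:SS^2\to\mathbb R$ on the unit tangent bundle is $K_m(x,v):=m^2K(x)-m\,df_x(\jmath_x v)+f(x)$. *)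

theory Defs
  imports "HOL-Analysis.Analysis"
begin

section \<open>Smooth maps and differential forms on subsets of Euclidean spaces\<close>

primrec higher_differentiable_on ::
  "'a::real_normed_vector set \<Rightarrow> ('a \<Rightarrow> 'b::real_normed_vector) \<Rightarrow> nat \<Rightarrow> bool" where
  "higher_differentiable_on U F 0 \<longleftrightarrow> continuous_on U F"
| "higher_differentiable_on U F (Suc k) \<longleftrightarrow>
     (\<forall>z\<in>U. F differentiable (at z)) \<and>
     (\<forall>w. higher_differentiable_on U (\<lambda>z. frechet_derivative F (at z) w) k)"

text \<open>The notion is only used for open \<open>U\<close>.\<close>
definition smooth_on ::
  "'a::real_normed_vector set \<Rightarrow> ('a \<Rightarrow> 'b::real_normed_vector) \<Rightarrow> bool" where
  "smooth_on U F \<longleftrightarrow> (\<forall>k. higher_differentiable_on U F k)"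

text \<open>Smoothness on a submanifold \<open>M\<close> of a Euclidean space: locally the map is the restriction of
  a smooth map on an open set of the ambient space.  Values outside \<open>M\<close> are irrelevant.\<close>
definition smooth_map_on ::
  "'a::euclidean_space set \<Rightarrow> ('a \<Rightarrow> 'b::real_normed_vector) \<Rightarrow> bool" where
  "smooth_map_on M F \<longleftrightarrow>
     (\<forall>p\<in>M. \<exists>U G. open U \<and> p \<in> U \<and> smooth_on U G \<and> (\<forall>z\<in>M \<inter> U. F z = G z))"

definition tangent_space :: "'a::euclidean_space set \<Rightarrow> 'a \<Rightarrow> 'a set" where
  "tangent_space M p =
     {w. \<exists>\<gamma> e. 0 < e \<and> smooth_on {-e<..<e} \<gamma> \<and> \<gamma> ` {-e<..<e} \<subseteq> M \<and> \<gamma> 0 = p \<and>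
           (\<gamma> has_vector_derivative w) (at (0::real))}"

text \<open>Forms are functions of a base point and of tangent vectors at it.\<close>
definition smooth_one_form ::
  "'a::euclidean_space set \<Rightarrow> ('a \<Rightarrow> 'a \<Rightarrow> real) \<Rightarrow> bool" where
  "smooth_one_form U \<Lambda> \<longleftrightarrow> (\<forall>z\<in>U. linear (\<Lambda> z)) \<and> (\<forall>w. smooth_on U (\<lambda>z. \<Lambda> z w))"

definition exterior_derivative ::
  "('a::euclidean_space \<Rightarrow> 'a \<Rightarrow> real) \<Rightarrow> 'a \<Rightarrow> 'a \<Rightarrow> 'a \<Rightarrow> real" where
  "exterior_derivative \<Lambda> z u w =
     frechet_derivative (\<lambda>y. \<Lambda> y w) (at z) u - frechet_derivative (\<lambda>y. \<Lambda> y u) (at z) w"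

text \<open>\<open>\<lambda>\<close> is a smooth one-form on the submanifold \<open>M\<close> and \<open>d\<lambda> = \<omega>\<close>.  The exterior derivative
  commutes with restriction, so it can be computed from any local extension \<open>\<Lambda>\<close> of \<open>\<lambda>\<close>.
  Only the values of \<open>\<lambda>\<close> and \<open>\<omega>\<close> on vectors tangent to \<open>M\<close> matter.\<close>
definition has_exterior_derivative_on ::
  "'a::euclidean_space set \<Rightarrow> ('a \<Rightarrow> 'a \<Rightarrow> real) \<Rightarrow> ('a \<Rightarrow> 'a \<Rightarrow> 'a \<Rightarrow> real) \<Rightarrow> bool" where
  "has_exterior_derivative_on M lam \<omega> \<longleftrightarrow>
     (\<forall>p\<in>M. \<exists>U \<Lambda>. open U \<and> p \<in> U \<and> smooth_one_form U \<Lambda> \<and>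
        (\<forall>z\<in>M \<inter> U.
           (\<forall>w\<in>tangent_space M z. lam z w = \<Lambda> z w) \<and>
           (\<forall>u\<in>tangent_space M z. \<forall>w\<in>tangent_space M z. \<omega> z u w = exterior_derivative \<Lambda> z u w)))"

text \<open>Contact forms on a three-dimensional submanifold \<open>M\<close>: the three-form \<open>\<lambda> \<and> d\<lambda>\<close>
  vanishes at no point.\<close>
definition contact_form_on ::
  "'a::euclidean_space set \<Rightarrow> ('a \<Rightarrow> 'a \<Rightarrow> real) \<Rightarrow> bool" where
  "contact_form_on M lam \<longleftrightarrow>
     (\<exists>\<omega>. has_exterior_derivative_on M lam \<omega> \<and>
        (\<forall>p\<in>M. \<exists>a\<in>tangent_space M p. \<exists>b\<in>tangent_space M p. \<exists>c\<in>tangent_space M p.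
           lam p a * \<omega> p b c + lam p b * \<omega> p c a + lam p c * \<omega> p a b \<noteq> 0))"


section \<open>Riemannian metrics on the two-sphere\<close>

abbreviation S2 :: "(real^3) set" where
  "S2 \<equiv> sphere 0 1"

definition TxS2 :: "real^3 \<Rightarrow> (real^3) set" where
  "TxS2 x = {v. x \<bullet> v = 0}"

definition TS2 :: "((real^3) \<times> (real^3)) set" where
  "TS2 = {(x, v). x \<in> S2 \<and> v \<in> TxS2 x}"

text \<open>\<open>g x u v\<close> is the inner product of \<open>u\<close>, \<open>v\<close> tangent to the sphere at \<open>x\<close>; all other values
  are irrelevant.\<close>
type_synonym metric = "real^3 \<Rightarrow> real^3 \<Rightarrow> real^3 \<Rightarrow> real"

definition riemannian_metric :: "metric \<Rightarrow> bool" where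
  "riemannian_metric g \<longleftrightarrow>
     (\<forall>x\<in>S2. \<forall>u\<in>TxS2 x. \<forall>v\<in>TxS2 x. \<forall>w\<in>TxS2 x. \<forall>a b.
        g x (a *\<^sub>R u + b *\<^sub>R v) w = a * g x u w + b * g x v w) \<and>
     (\<forall>x\<in>S2. \<forall>u\<in>TxS2 x. \<forall>v\<in>TxS2 x. g x u v = g x v u) \<and>
     (\<forall>x\<in>S2. \<forall>u\<in>TxS2 x. u \<noteq> 0 \<longrightarrow> 0 < g x u u) \<and>
     smooth_map_on {(x, u, v). x \<in> S2 \<and> u \<in> TxS2 x \<and> v \<in> TxS2 x} (\<lambda>(x, u, v). g x u v)"

text \<open>The sphere is oriented by the outward normal: \<open>(u, v)\<close> is a positive basis of the tangent
  plane at \<open>x\<close> iff \<open>x \<bullet> cross3 u v > 0\<close>.\<close>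
definition area_form :: "metric \<Rightarrow> real^3 \<Rightarrow> real^3 \<Rightarrow> real^3 \<Rightarrow> real" where
  "area_form g x u v = sgn (x \<bullet> cross3 u v) * sqrt (g x u u * g x v v - (g x u v)\<^sup>2)"

definition rot :: "metric \<Rightarrow> real^3 \<Rightarrow> real^3 \<Rightarrow> real^3" where
  "rot g x v = (THE w. w \<in> TxS2 x \<and> g x v w = 0 \<and> g x w w = g x v v \<and>
                       (v \<noteq> 0 \<longrightarrow> 0 < x \<bullet> cross3 v w))"

text \<open>The integral of a two-form over the oriented sphere, as the integral of its pullback under
  spherical coordinates (polar angle, azimuth), an orientation-preserving diffeomorphism from the
  open rectangle onto the complement of a null set.\<close>
definition spherical :: "real \<times> real \<Rightarrow> real^3" where
  "spherical = (\<lambda>(a, b). vector [sin a * cos b, sin a * sin b, cos a])"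

definition integral_S2 :: "(real^3 \<Rightarrow> real^3 \<Rightarrow> real^3 \<Rightarrow> real) \<Rightarrow> real" where
  "integral_S2 \<sigma> = integral (cbox (0, 0) (pi, 2 * pi))
     (\<lambda>q. \<sigma> (spherical q) (frechet_derivative spherical (at q) (1, 0))
                          (frechet_derivative spherical (at q) (0, 1)))"


section \<open>Gaussian curvature\<close>

text \<open>The coordinate formulas for the Levi-Civita connection and the Riemann tensor of a metric \<open>h\<close>
  on an open subset of a vector space \<open>V\<close>, written with constant vector fields \<open>u\<close>, \<open>v\<close>, \<open>w\<close>
  in place of coordinate fields:
  \<open>2 h(\<Gamma>(u,v),w) = \<partial>\<^sub>u h(v,w) + \<partial>\<^sub>v h(u,w) - \<partial>\<^sub>w h(u,v)\<close> and
  \<open>R(u,v)w = \<partial>\<^sub>u \<Gamma>(v,w) - \<partial>\<^sub>v \<Gamma>(u,w) + \<Gamma>(u,\<Gamma>(v,w)) - \<Gamma>(v,\<Gamma>(u,w))\<close>.\<close>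

definition dir_deriv ::
  "('a::real_normed_vector \<Rightarrow> 'b::real_normed_vector) \<Rightarrow> 'a \<Rightarrow> 'a \<Rightarrow> 'b" where
  "dir_deriv F y w = vector_derivative (\<lambda>t. F (y + t *\<^sub>R w)) (at 0)"

definition christoffel ::
  "'a::real_normed_vector set \<Rightarrow> ('a \<Rightarrow> 'a \<Rightarrow> 'a \<Rightarrow> real) \<Rightarrow> 'a \<Rightarrow> 'a \<Rightarrow> 'a \<Rightarrow> 'a" where
  "christoffel V h y u v = (THE c. c \<in> V \<and>
     (\<forall>w\<in>V. 2 * h y c w = dir_deriv (\<lambda>y. h y v w) y u + dir_deriv (\<lambda>y. h y u w) y v
                          - dir_deriv (\<lambda>y. h y u v) y w))"

definition riemann_tensor ::
  "'a::real_normed_vector set \<Rightarrow> ('a \<Rightarrow> 'a \<Rightarrow> 'a \<Rightarrow> real) \<Rightarrow> 'a \<Rightarrow> 'a \<Rightarrow> 'a \<Rightarrow> 'a \<Rightarrow> 'a" where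
  "riemann_tensor V h y u v w =
     (let \<Gamma> = christoffel V h in
       dir_deriv (\<lambda>y. \<Gamma> y v w) y u - dir_deriv (\<lambda>y. \<Gamma> y u w) y v
       + \<Gamma> y u (\<Gamma> y v w) - \<Gamma> y v (\<Gamma> y u w))"

text \<open>Inverse stereographic projection from the antipode of \<open>x\<close>, a smooth parametrization of
  \<open>S2 - {-x}\<close> by the tangent plane at \<open>x\<close>; it maps \<open>0\<close> to \<open>x\<close> and its derivative at \<open>0\<close> is the
  identity of the tangent plane.\<close>
definition stereo :: "real^3 \<Rightarrow> real^3 \<Rightarrow> real^3" where
  "stereo x y = (1 / (4 + y \<bullet> y)) *\<^sub>R ((4 - y \<bullet> y) *\<^sub>R x + 4 *\<^sub>R y)"

definition chart_metric :: "metric \<Rightarrow> real^3 \<Rightarrow> metric" where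
  "chart_metric g x y u v = g (stereo x y) (frechet_derivative (stereo x) (at y) u)
                                           (frechet_derivative (stereo x) (at y) v)"

text \<open>The Riemann tensor does not depend on the chart; it is evaluated at \<open>x\<close> in the chart
  \<open>stereo x\<close>.  The Gaussian curvature is the number \<open>k\<close> with
  \<open>g(R(u,v)v,u) = k (g(u,u) g(v,v) - g(u,v)\<^sup>2)\<close>.\<close>
definition gauss_curvature :: "metric \<Rightarrow> real^3 \<Rightarrow> real" where
  "gauss_curvature g x = (THE k. \<forall>u\<in>TxS2 x. \<forall>v\<in>TxS2 x.
     g x (riemann_tensor (TxS2 x) (chart_metric g x) 0 u v v) u
       = k * (g x u u * g x v v - (g x u v)\<^sup>2))"


section \<open>Magnetic systems on the two-sphere\<close>

definition magnetic_form ::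
  "metric \<Rightarrow> (real^3 \<Rightarrow> real) \<Rightarrow> real^3 \<Rightarrow> real^3 \<Rightarrow> real^3 \<Rightarrow> real" where
  "magnetic_form g f x u v = f x * area_form g x u v"

definition liouville_form ::
  "metric \<Rightarrow> (real^3) \<times> (real^3) \<Rightarrow> (real^3) \<times> (real^3) \<Rightarrow> real" where
  "liouville_form g = (\<lambda>(x, v) \<xi>. g x v (fst \<xi>))"

definition energy_level :: "metric \<Rightarrow> real \<Rightarrow> ((real^3) \<times> (real^3)) set" where
  "energy_level g c = {(x, v). (x, v) \<in> TS2 \<and> g x v v / 2 = c}"

text \<open>The differential of the projection \<open>(x, v) \<mapsto> x\<close> is \<open>fst\<close>.  The two-form \<open>d\<alpha>\<close> is the one
  of \<open>\<alpha>\<close> on all of \<open>TS2\<close>.\<close>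
definition contact_type :: "metric \<Rightarrow> (real^3 \<Rightarrow> real^3 \<Rightarrow> real^3 \<Rightarrow> real) \<Rightarrow> real \<Rightarrow> bool" where
  "contact_type g \<sigma> c \<longleftrightarrow>
     (\<exists>d\<alpha> lam. has_exterior_derivative_on TS2 (liouville_form g) d\<alpha> \<and>
        has_exterior_derivative_on (energy_level g c) lam
          (\<lambda>z \<xi> \<eta>. d\<alpha> z \<xi> \<eta> - \<sigma> (fst z) (fst \<xi>) (fst \<eta>)) \<and>
        contact_form_on (energy_level g c) lam)"

definition unit_tangent_bundle :: "metric \<Rightarrow> ((real^3) \<times> (real^3)) set" where
  "unit_tangent_bundle g = {(x, v). (x, v) \<in> TS2 \<and> g x v v = 1}"

text \<open>The derivative of \<open>f\<close> within the sphere is determined on vectors tangent to the sphere, and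
  it is only applied to such a vector.\<close>
definition magnetic_curvature ::
  "metric \<Rightarrow> (real^3 \<Rightarrow> real) \<Rightarrow> real \<Rightarrow> real^3 \<Rightarrow> real^3 \<Rightarrow> real" where
  "magnetic_curvature g f m x v =
     m\<^sup>2 * gauss_curvature g x - m * frechet_derivative f (at x within S2) (rot g x v) + f x"

end

theory Submission
  imports Defs
begin

text \<open>On the round sphere take \<open>f = 1/6 + 5/2 z\<^sup>2\<close> and \<open>m = 1\<close>, so that the energy level is the unit
  tangent bundle.  Since \<open>f - 1\<close> is a multiple of the Legendre polynomial of degree two, \<open>(1 - f) \<mu>\<close>
  has the primitive \<open>\<beta> = - 5/6 z (x dy - y dx)\<close>, which is small in the supremum norm although the
  gradient of \<open>f\<close> is not.  With the connection form \<open>\<psi>\<close>, the form \<open>\<lambda> = \<alpha> + \<psi> + \<beta>\<close> is a primitive of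
  \<open>d\<alpha> - f \<mu>\<close>, and evaluating \<open>\<lambda> \<and> d\<lambda>\<close> on the geodesic, the orthogonal horizontal and the vertical
  field gives \<open>- (1 + f + \<beta>(v))\<close>, where \<open>\<bar>\<beta>(v)\<bar> \<le> 5/6\<close>.  On the other hand the magnetic curvature is
  \<open>1 - 12/5 + 16/15 = - 1/3\<close> at \<open>(4/5, 0, 3/5)\<close> if \<open>j v\<close> points north.\<close>

unbundle cross3_syntax

section \<open>Calculus of smooth maps\<close>

lemma higher_differentiable_on_subset:
  "higher_differentiable_on T F k \<Longrightarrow> S \<subseteq> T \<Longrightarrow> higher_differentiable_on S F k"
  by (induction k arbitrary: F) (auto intro: continuous_on_subset)

lemma smooth_on_subset: "smooth_on T F \<Longrightarrow> S \<subseteq> T \<Longrightarrow> smooth_on S F"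
  unfolding smooth_on_def using higher_differentiable_on_subset by blast

lemma higher_differentiable_on_SucD:
  "higher_differentiable_on S F (Suc k) \<Longrightarrow> higher_differentiable_on S F k"
proof (induction k arbitrary: F)
  case 0
  then show ?case
    by (auto intro!: differentiable_imp_continuous_on
        simp: differentiable_on_def differentiable_at_withinI)
next
  case (Suc k)
  then show ?case by (metis higher_differentiable_on.simps(2))
qed

text \<open>Derivatives are unique, so any family \<open>D\<close> found by the derivative rules can
  stand in for \<open>frechet_derivative\<close>, and inductions on the order run on explicit
  formulas.\<close>

lemma higher_differentiable_on_UNIV_SucI:
  assumes "\<And>z. (F has_derivative D z) (at z)"
    and "\<And>w. higher_differentiable_on UNIV (\<lambda>z. D z w) k"
  shows "higher_differentiable_on UNIV F (Suc k)"
proof -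
  have "frechet_derivative F (at z) = D z" for z
    using assms(1) frechet_derivative_at by metis
  then show ?thesis
    using assms by (auto simp: differentiable_def)
qed

lemma higher_differentiable_on_const: "higher_differentiable_on UNIV (\<lambda>z. c) k"
proof (induction k arbitrary: c)
  case (Suc k)
  show ?case
    by (rule higher_differentiable_on_UNIV_SucI[where D="\<lambda>z w. 0"]) (auto intro: Suc)
qed simp

lemma smooth_on_const: "smooth_on UNIV (\<lambda>z. c)"
  by (simp add: smooth_on_def higher_differentiable_on_const)

lemma smooth_on_bounded_linear:
  assumes "bounded_linear L"
  shows "smooth_on UNIV L"
  unfolding smooth_on_def
proof
  fix k
  show "higher_differentiable_on UNIV L k"
  proof (cases k)
    case 0
    then show ?thesis
      using assms by (simp add: linear_continuous_on)
  next
    case (Suc j)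
    have "higher_differentiable_on UNIV L (Suc j)"
      by (rule higher_differentiable_on_UNIV_SucI[where D="\<lambda>z. L"])
        (use higher_differentiable_on_const assms in \<open>auto simp: bounded_linear_imp_has_derivative\<close>)
    then show ?thesis using Suc by simp
  qed
qed

lemma higher_differentiable_on_add:
  "higher_differentiable_on UNIV F k \<Longrightarrow> higher_differentiable_on UNIV G k \<Longrightarrow>
    higher_differentiable_on UNIV (\<lambda>z. F z + G z) k"
proof (induction k arbitrary: F G)
  case 0
  then show ?case by (auto intro: continuous_intros)
next
  case (Suc k)
  show ?case
    by (rule higher_differentiable_on_UNIV_SucI[where
          D="\<lambda>z w. frechet_derivative F (at z) w + frechet_derivative G (at z) w"])
      (use Suc in \<open>auto intro!: has_derivative_add simp: frechet_derivative_works\<close>)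
qed

lemma smooth_on_add:
  "smooth_on UNIV F \<Longrightarrow> smooth_on UNIV G \<Longrightarrow> smooth_on UNIV (\<lambda>z. F z + G z)"
  by (simp add: smooth_on_def higher_differentiable_on_add)

text \<open>By the Leibniz rule the derivative is a sum of two expressions of the same shape, so an
  induction over all pairs \<open>F\<close>, \<open>G\<close> closes. It serves products, inner
  products and cross products alike.\<close>

lemma smooth_on_bilinear:
  assumes "bounded_bilinear B" "smooth_on UNIV F" "smooth_on UNIV G"
  shows "smooth_on UNIV (\<lambda>z. B (F z) (G z))"
proof -
  have "higher_differentiable_on UNIV F k \<Longrightarrow> higher_differentiable_on UNIV G k \<Longrightarrow>
    higher_differentiable_on UNIV (\<lambda>z. B (F z) (G z)) k" for k
  proof (induction k arbitrary: F G)
    case 0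
    then show ?case by (auto intro: bounded_bilinear.continuous_on[OF assms(1)])
  next
    case (Suc k)
    \<comment> \<open>Each Leibniz term keeps one undifferentiated factor, whose order has to drop
      to \<open>k\<close> as well before the induction hypothesis applies.\<close>
    have FG: "higher_differentiable_on UNIV F k" "higher_differentiable_on UNIV G k"
      using Suc.prems by (auto intro: higher_differentiable_on_SucD)
    have "higher_differentiable_on UNIV (\<lambda>z. B (F z) (frechet_derivative G (at z) w)) k"
      "higher_differentiable_on UNIV (\<lambda>z. B (frechet_derivative F (at z) w) (G z)) k" for w
      using Suc.prems FG by (auto intro!: Suc.IH)
    then have "higher_differentiable_on UNIV (\<lambda>z. B (F z) (frechet_derivative G (at z) w)
        + B (frechet_derivative F (at z) w) (G z)) k" for w
      by (intro higher_differentiable_on_add)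
    then show ?case
      using Suc.prems
      by (intro higher_differentiable_on_UNIV_SucI[where
            D="\<lambda>z w. B (F z) (frechet_derivative G (at z) w)
              + B (frechet_derivative F (at z) w) (G z)"])
        (auto intro!: bounded_bilinear.FDERIV[OF assms(1)] simp: frechet_derivative_works)
  qed
  then show ?thesis using assms(2,3) by (simp add: smooth_on_def)
qed

text \<open>The family is closed under differentiation: up to scaling, \<open>(a, b, c)\<close>
  turns into \<open>(b, - a, 0)\<close>.\<close>

lemma smooth_on_trig_curve:
  fixes a b c :: "'a::real_normed_vector"
  shows "smooth_on UNIV (\<lambda>t::real. cos t *\<^sub>R a + sin t *\<^sub>R b + c)"
proof -
  have "higher_differentiable_on UNIV (\<lambda>t::real. cos t *\<^sub>R a + sin t *\<^sub>R b + c) k" for k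
  proof (induction k arbitrary: a b c)
    case 0
    then show ?case by (auto intro!: continuous_intros)
  next
    case (Suc k)
    show ?case
    proof (rule higher_differentiable_on_UNIV_SucI)
      show "((\<lambda>t. cos t *\<^sub>R a + sin t *\<^sub>R b + c) has_derivative
          (\<lambda>s. s *\<^sub>R (cos t *\<^sub>R b - sin t *\<^sub>R a))) (at t)" for t
        by (auto intro!: derivative_eq_intros simp: algebra_simps)
      fix s :: real
      show "higher_differentiable_on UNIV (\<lambda>t. s *\<^sub>R (cos t *\<^sub>R b - sin t *\<^sub>R a)) k"
        using Suc[of "s *\<^sub>R b" "- (s *\<^sub>R a)" 0] by (simp add: algebra_simps)
    qed
  qed
  then show ?thesis by (simp add: smooth_on_def)
qed

lemma smooth_map_on_UNIV: "smooth_on UNIV F \<Longrightarrow> smooth_map_on M F"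
  unfolding smooth_map_on_def by (metis Int_iff UNIV_I open_UNIV)

lemma bounded_bilinear_cross3: "bounded_bilinear (\<times>)"
  using bilinear_cross by (simp add: bilinear_conv_bounded_bilinear)

section \<open>Tangent spaces and exterior derivatives\<close>

text \<open>At time \<open>0\<close> the curve passes through \<open>a + c\<close> with velocity
  \<open>b\<close>. This is how vectors are shown to be tangent.\<close>

lemma trig_curve_tangent:
  fixes a b c :: "'a::euclidean_space"
  assumes "\<And>t. cos t *\<^sub>R a + sin t *\<^sub>R b + c \<in> M"
  shows "b \<in> tangent_space M (a + c)"
proof -
  have "((\<lambda>t. cos t *\<^sub>R a + sin t *\<^sub>R b + c) has_vector_derivative b) (at 0)"
    by (auto intro!: derivative_eq_intros simp: has_vector_derivative_def)
  moreover have "smooth_on {-1<..<1::real} (\<lambda>t. cos t *\<^sub>R a + sin t *\<^sub>R b + c)"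
    using smooth_on_trig_curve smooth_on_subset by blast
  ultimately show ?thesis
    unfolding tangent_space_def using assms
    by (intro CollectI exI[of _ "\<lambda>t. cos t *\<^sub>R a + sin t *\<^sub>R b + c"] exI[of _ 1]) auto
qed

text \<open>Along a curve in \<open>M\<close> with velocity \<open>w\<close> the function is
  constant, and the chain rule identifies the derivative of that constant with
  \<open>\<phi>' w\<close>. This bounds tangent spaces from above.\<close>

lemma tangent_space_constraint:
  fixes \<phi> :: "'a::euclidean_space \<Rightarrow> real"
  assumes w: "w \<in> tangent_space M p"
    and \<phi>: "(\<phi> has_derivative \<phi>') (at p)" "\<And>q. q \<in> M \<Longrightarrow> \<phi> q = k"
  shows "\<phi>' w = 0"
proof -
  obtain \<gamma> e where \<gamma>: "0 < e" "\<gamma> ` {-e<..<e} \<subseteq> M" "\<gamma> 0 = p"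
    "(\<gamma> has_vector_derivative w) (at (0::real))"
    using w unfolding tangent_space_def by blast
  have "((\<phi> \<circ> \<gamma>) has_derivative \<phi>' \<circ> (\<lambda>t. t *\<^sub>R w)) (at 0)"
    using \<gamma> \<phi>(1) by (intro diff_chain_at) (auto simp: has_vector_derivative_def)
  then have "((\<lambda>t. k) has_derivative \<phi>' \<circ> (\<lambda>t. t *\<^sub>R w)) (at (0::real))"
    by (rule has_derivative_transform_within_open[of _ _ _ _ "{-e<..<e}"])
      (use \<gamma> \<phi>(2) in \<open>auto simp: image_subset_iff\<close>)
  then have "\<phi>' \<circ> (\<lambda>t. t *\<^sub>R w) = (\<lambda>t. 0)"
    by (rule has_derivative_unique) simp
  from fun_cong[OF this, of 1] show ?thesis by simp
qed

text \<open>A form given on the whole ambient space is its own local extension around every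
  point.\<close>

lemma has_exterior_derivative_on_global:
  assumes "smooth_one_form UNIV \<Lambda>"
    and "\<And>z u w. z \<in> M \<Longrightarrow> u \<in> tangent_space M z \<Longrightarrow> w \<in> tangent_space M z \<Longrightarrow>
           \<omega> z u w = exterior_derivative \<Lambda> z u w"
  shows "has_exterior_derivative_on M \<Lambda> \<omega>"
  unfolding has_exterior_derivative_on_def
  using assms by (intro ballI exI[of _ UNIV] exI[of _ \<Lambda>]) auto

lemma exterior_derivative_eqI:
  assumes "\<And>w. ((\<lambda>y. \<Lambda> y w) has_derivative D w) (at z)"
  shows "exterior_derivative \<Lambda> z u w = D w u - D u w"
  unfolding exterior_derivative_def using assms frechet_derivative_at by metis

section \<open>Tangent planes of the sphere\<close>

text \<open>The double cross product formula gives \<open>x \<times> (u \<times> w) = 0\<close>, so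
  \<open>u \<times> w\<close> is parallel to \<open>x\<close>. A vector is determined by its inner
  and cross products with a nonzero vector.\<close>

lemma cross3_tangent:
  assumes "x \<in> S2" "u \<in> TxS2 x" "w \<in> TxS2 x"
  shows "u \<times> w = (x \<bullet> (u \<times> w)) *\<^sub>R x"
proof -
  have "x \<times> (u \<times> w) = 0"
    using assms by (simp add: TxS2_def Lagrange)
  moreover have "x \<bullet> x = 1"
    using assms by (simp add: dot_square_norm)
  moreover from this have "x \<noteq> 0"
    by auto
  ultimately show ?thesis
    using cross_dot_cancel[of x "u \<times> w" "(x \<bullet> (u \<times> w)) *\<^sub>R x"]
    by (simp add: cross_mult_right)
qed

text \<open>A unit tangent \<open>v\<close> and \<open>x \<times> v\<close> form an orthonormal
  basis of the tangent plane. Both sides have the same inner and cross products with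
  \<open>x \<times> v\<close>.\<close>

lemma tangent_frame:
  assumes "x \<in> S2" "v \<in> TxS2 x" "v \<bullet> v = 1" "u \<in> TxS2 x"
  shows "u = (u \<bullet> v) *\<^sub>R v + (u \<bullet> (x \<times> v)) *\<^sub>R (x \<times> v)"
proof -
  have x: "x \<bullet> x = 1" and xv: "x \<bullet> v = 0" and xu: "x \<bullet> u = 0"
    using assms by (auto simp: TxS2_def dot_square_norm)
  let ?n = "x \<times> v"
  have nn: "?n \<bullet> ?n = 1"
    using assms(3) x xv by (simp add: dot_cross inner_commute)
  have "?n \<times> u = (u \<bullet> v) *\<^sub>R (?n \<times> v)"
    using xu xv assms(3) x
    by (simp add: cross_skew[of "x \<times> v"] Lagrange inner_commute)
  moreover have "?n \<noteq> 0"
    using nn by auto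
  ultimately show ?thesis
    using nn cross_dot_cancel[of ?n u "(u \<bullet> v) *\<^sub>R v + (u \<bullet> ?n) *\<^sub>R ?n"]
    by (simp add: cross_add_right cross_mult_right inner_add_right dot_cross_self inner_commute)
qed

section \<open>The round metric, its area form and its rotation\<close>

definition round_metric :: metric where
  "round_metric x u v = u \<bullet> v"

lemma riemannian_metric_round: "riemannian_metric round_metric"
proof -
  have "smooth_on UNIV (\<lambda>z::(real^3) \<times> (real^3) \<times> (real^3). fst (snd z) \<bullet> snd (snd z))"
    by (intro smooth_on_bilinear[OF bounded_bilinear_inner]
        smooth_on_bounded_linear bounded_linear_intros)
  then show ?thesis
    unfolding riemannian_metric_def round_metric_def
    by (auto simp: inner_add_left case_prod_beta' intro: inner_commute intro!: smooth_map_on_UNIV)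
qed

text \<open>The Gram determinant is the squared length of \<open>u \<times> w\<close>, a multiple of
  the unit normal \<open>x\<close>. Its root is the absolute value of the triple product, and
  \<open>sgn\<close> restores the sign.\<close>

lemma area_form_round:
  assumes "x \<in> S2" "u \<in> TxS2 x" "w \<in> TxS2 x"
  shows "area_form round_metric x u w = x \<bullet> (u \<times> w)"
proof -
  have "u \<bullet> u * (w \<bullet> w) - (u \<bullet> w)\<^sup>2 = (norm (u \<times> w))\<^sup>2"
    by (simp add: norm_cross dot_square_norm)
  also have "\<dots> = (x \<bullet> (u \<times> w))\<^sup>2"
    using assms cross3_tangent[OF assms] by (metis mem_sphere_0 mult.right_neutral norm_scaleR power2_abs)
  finally show ?thesis
    by (simp add: area_form_def round_metric_def mult.commute[of "sgn _"] abs_mult_sgn)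
qed

lemma rot_round:
  assumes "x \<in> S2" "v \<in> TxS2 x" "v \<bullet> v = 1"
  shows "rot round_metric x v = x \<times> v"
  unfolding rot_def round_metric_def
proof (rule the_equality)
  have x: "x \<bullet> x = 1" and xv: "x \<bullet> v = 0" and v0: "v \<noteq> 0"
    using assms by (auto simp: TxS2_def dot_square_norm)
  have nn: "(x \<times> v) \<bullet> (x \<times> v) = 1"
    using assms(3) x xv by (simp add: dot_cross inner_commute)
  have tri: "x \<bullet> (v \<times> w) = (x \<times> v) \<bullet> w" for w
    by (metis cross_triple inner_commute)
  show "x \<times> v \<in> TxS2 x \<and> v \<bullet> (x \<times> v) = 0 \<and> (x \<times> v) \<bullet> (x \<times> v) = v \<bullet> v \<and>
      (v \<noteq> 0 \<longrightarrow> 0 < x \<bullet> v \<times> x \<times> v)"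
    using assms(3) nn by (simp add: TxS2_def dot_cross_self tri)
  fix w assume w: "w \<in> TxS2 x \<and> v \<bullet> w = 0 \<and> w \<bullet> w = v \<bullet> v \<and> (v \<noteq> 0 \<longrightarrow> 0 < x \<bullet> v \<times> w)"
  \<comment> \<open>Orthogonality to \<open>v\<close> leaves only the multiple \<open>?c\<close> of
    \<open>x \<times> v\<close>; the orientation makes it positive and the length makes its square
    one.\<close>
  let ?c = "w \<bullet> (x \<times> v)"
  have w_eq: "w = ?c *\<^sub>R (x \<times> v)"
    using tangent_frame[OF assms, of w] w by (simp add: inner_commute)
  have "?c > 0"
    using w v0 by (simp add: tri inner_commute)
  moreover have "?c * ?c = 1"
    using w assms(3) nn by (metis inner_scaleR_left inner_scaleR_right mult.right_neutral w_eq)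
  ultimately have "?c = 1"
    by (metis abs_of_pos less_eq_real_def power2_eq_1_iff power2_eq_square less_asym zero_less_one neg_less_0_iff_less)
  then show "w = x \<times> v"
    using w_eq by simp
qed

section \<open>The round sphere has curvature one\<close>

lemma stereo_has_derivative:
  "(stereo x has_derivative
     (\<lambda>u. (1 / (4 + y \<bullet> y)) *\<^sub>R (4 *\<^sub>R u - (2 * (y \<bullet> u)) *\<^sub>R x)
        - (2 * (y \<bullet> u) / (4 + y \<bullet> y)\<^sup>2) *\<^sub>R ((4 - y \<bullet> y) *\<^sub>R x + 4 *\<^sub>R y))) (at y)"
proof -
  have "4 + y \<bullet> y \<noteq> 0"
    using inner_ge_zero[of y] by linarith
  then have "((\<lambda>y. 1 / (4 + y \<bullet> y)) has_derivative (\<lambda>u. - (2 * (y \<bullet> u) / (4 + y \<bullet> y)\<^sup>2))) (at y)"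
    by (auto intro!: derivative_eq_intros simp: inner_commute power2_eq_square)
  moreover have "((\<lambda>y. (4 - y \<bullet> y) *\<^sub>R x + 4 *\<^sub>R y) has_derivative
      (\<lambda>u. 4 *\<^sub>R u - (2 * (y \<bullet> u)) *\<^sub>R x)) (at y)"
    by (auto intro!: derivative_eq_intros simp: inner_commute algebra_simps)
  ultimately have "((\<lambda>y. (1 / (4 + y \<bullet> y)) *\<^sub>R ((4 - y \<bullet> y) *\<^sub>R x + 4 *\<^sub>R y)) has_derivative
     (\<lambda>u. (1 / (4 + y \<bullet> y)) *\<^sub>R (4 *\<^sub>R u - (2 * (y \<bullet> u)) *\<^sub>R x)
        + (- (2 * (y \<bullet> u) / (4 + y \<bullet> y)\<^sup>2)) *\<^sub>R ((4 - y \<bullet> y) *\<^sub>R x + 4 *\<^sub>R y))) (at y)"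
    by (rule has_derivative_scaleR)
  moreover have "stereo x = (\<lambda>y. (1 / (4 + y \<bullet> y)) *\<^sub>R ((4 - y \<bullet> y) *\<^sub>R x + 4 *\<^sub>R y))"
    by (simp add: stereo_def fun_eq_iff)
  ultimately show ?thesis
    by simp
qed

text \<open>Stereographic projection is conformal. The curvature computation rests on this conformal
  factor alone.\<close>

lemma chart_metric_round:
  assumes x: "x \<in> S2" and "y \<in> TxS2 x" "u \<in> TxS2 x" "v \<in> TxS2 x"
  shows "chart_metric round_metric x y u v = 16 / (4 + y \<bullet> y)\<^sup>2 * (u \<bullet> v)"
proof -
  have *: "frechet_derivative (stereo x) (at y) = (\<lambda>u. (1 / (4 + y \<bullet> y)) *\<^sub>R (4 *\<^sub>R u - (2 * (y \<bullet> u)) *\<^sub>R x)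
        - (2 * (y \<bullet> u) / (4 + y \<bullet> y)\<^sup>2) *\<^sub>R ((4 - y \<bullet> y) *\<^sub>R x + 4 *\<^sub>R y))"
    using frechet_derivative_at[OF stereo_has_derivative] by simp
  have xx: "x \<bullet> x = 1" and xy: "x \<bullet> y = 0" "y \<bullet> x = 0" and xu: "x \<bullet> u = 0" "u \<bullet> x = 0"
    and xv: "x \<bullet> v = 0" "v \<bullet> x = 0"
    using assms by (auto simp: TxS2_def dot_square_norm inner_commute)
  define r where "r = y \<bullet> y"
  have r: "4 + r \<noteq> 0"
    using inner_ge_zero[of y] unfolding r_def by linarith
  show ?thesis
    unfolding chart_metric_def round_metric_def *
    using r by (simp add: inner_diff_left inner_diff_right inner_add_left inner_add_right xx xy xu xv
        r_def[symmetric] inner_commute[of u y] inner_commute[of v y] power2_eq_square)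
     (simp add: divide_simps, simp add: algebra_simps)
qed

text \<open>For a conformal metric with factor \<open>exp (2 \<phi>)\<close> the connection is
  \<open>d\<phi>(u) v + d\<phi>(v) u - (u \<bullet> v) grad \<phi>\<close>. Here
  \<open>exp \<phi> = 4 / (4 + y \<bullet> y)\<close>, hence
  \<open>grad \<phi> = - 2 y / (4 + y \<bullet> y)\<close>.\<close>

definition round_christoffel :: "real^3 \<Rightarrow> real^3 \<Rightarrow> real^3 \<Rightarrow> real^3" where
  "round_christoffel y u v =
     (- 2 / (4 + y \<bullet> y)) *\<^sub>R ((y \<bullet> u) *\<^sub>R v + (y \<bullet> v) *\<^sub>R u - (u \<bullet> v) *\<^sub>R y)"

lemma chart_metric_round_dir_deriv:
  assumes "x \<in> S2" "y \<in> TxS2 x" "u \<in> TxS2 x" "v \<in> TxS2 x" "w \<in> TxS2 x"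
  shows "dir_deriv (\<lambda>y. chart_metric round_metric x y u v) y w
    = - 64 * (y \<bullet> w) / (4 + y \<bullet> y) ^ 3 * (u \<bullet> v)"
proof -
  \<comment> \<open>The conformal formula holds only for points of the tangent plane, and this line
    stays inside it.\<close>
  have "y + t *\<^sub>R w \<in> TxS2 x" for t
    using assms by (simp add: TxS2_def inner_add_right)
  then have "(\<lambda>t. chart_metric round_metric x (y + t *\<^sub>R w) u v)
      = (\<lambda>t. 16 / (4 + (y + t *\<^sub>R w) \<bullet> (y + t *\<^sub>R w))\<^sup>2 * (u \<bullet> v))"
    using assms by (simp add: chart_metric_round)
  moreover have "((\<lambda>t. 16 / (4 + (y + t *\<^sub>R w) \<bullet> (y + t *\<^sub>R w))\<^sup>2 * (u \<bullet> v)) has_vector_derivative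
      - 64 * (y \<bullet> w) / (4 + y \<bullet> y) ^ 3 * (u \<bullet> v)) (at 0)"
  proof -
    define r where "r = y \<bullet> y"
    have r: "4 + r \<noteq> 0"
      using inner_ge_zero[of y] unfolding r_def by linarith
    have e: "(y + t *\<^sub>R w) \<bullet> (y + t *\<^sub>R w) = r + 2 * t * (y \<bullet> w) + t\<^sup>2 * (w \<bullet> w)" for t
      by (simp add: r_def inner_add_left inner_add_right inner_commute power2_eq_square algebra_simps)
    show ?thesis
      unfolding e r_def[symmetric] has_real_derivative_iff_has_vector_derivative[symmetric]
      using r
      by (auto intro!: derivative_eq_intros simp: divide_simps) 
        (simp add: power2_eq_square power3_eq_cube power4_eq_xxxx algebra_simps)
  qed
  ultimately show ?thesis
    unfolding dir_deriv_def by (simp only: vector_derivative_at)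
qed

lemma christoffel_round:
  assumes "x \<in> S2" "y \<in> TxS2 x" "u \<in> TxS2 x" "v \<in> TxS2 x"
  shows "christoffel (TxS2 x) (chart_metric round_metric x) y u v = round_christoffel y u v"
  unfolding christoffel_def
proof (rule the_equality)
  define r where "r = 4 + y \<bullet> y"
  have r: "r > 0"
    using inner_ge_zero[of y] unfolding r_def by linarith
  have mem: "round_christoffel y u v \<in> TxS2 x"
    using assms by (simp add: round_christoffel_def TxS2_def inner_add_right inner_diff_right)
  have "2 * chart_metric round_metric x y (round_christoffel y u v) w =
      dir_deriv (\<lambda>y. chart_metric round_metric x y v w) y u +
      dir_deriv (\<lambda>y. chart_metric round_metric x y u w) y v -
      dir_deriv (\<lambda>y. chart_metric round_metric x y u v) y w" if "w \<in> TxS2 x" for w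
  proof -
    have "round_christoffel y u v \<bullet> w =
        - 2 / r * ((y \<bullet> u) * (v \<bullet> w) + (y \<bullet> v) * (u \<bullet> w) - (u \<bullet> v) * (y \<bullet> w))"
      by (simp add: round_christoffel_def r_def inner_add_left inner_diff_left)
    then show ?thesis
      using that assms mem r
      by (simp add: chart_metric_round chart_metric_round_dir_deriv r_def[symmetric])
        (simp add: power2_eq_square power3_eq_cube field_simps)
  qed
  with mem show eq: "round_christoffel y u v \<in> TxS2 x \<and> (\<forall>w\<in>TxS2 x.
      2 * chart_metric round_metric x y (round_christoffel y u v) w =
      dir_deriv (\<lambda>y. chart_metric round_metric x y v w) y u +
      dir_deriv (\<lambda>y. chart_metric round_metric x y u w) y v -
      dir_deriv (\<lambda>y. chart_metric round_metric x y u v) y w)"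
    by blast
  fix c assume c: "c \<in> TxS2 x \<and> (\<forall>w\<in>TxS2 x. 2 * chart_metric round_metric x y c w =
      dir_deriv (\<lambda>y. chart_metric round_metric x y v w) y u +
      dir_deriv (\<lambda>y. chart_metric round_metric x y u w) y v -
      dir_deriv (\<lambda>y. chart_metric round_metric x y u v) y w)"
  \<comment> \<open>Testing the defining equation of both solutions with their difference shows that
    the difference is orthogonal to itself.\<close>
  let ?d = "c - round_christoffel y u v"
  have d: "?d \<in> TxS2 x"
    using c mem by (simp add: TxS2_def inner_diff_right)
  then have "chart_metric round_metric x y c ?d = chart_metric round_metric x y (round_christoffel y u v) ?d"
    using c eq by (metis mult_cancel_left zero_neq_numeral)
  then have "c \<bullet> ?d = round_christoffel y u v \<bullet> ?d"
    using c mem d assms r by (simp add: chart_metric_round r_def[symmetric])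
  then have "?d \<bullet> ?d = 0"
    by (simp add: inner_diff_left)
  then show "c = round_christoffel y u v"
    by simp
qed

lemma dir_deriv_round_christoffel:
  assumes "x \<in> S2" "u \<in> TxS2 x" "v \<in> TxS2 x" "w \<in> TxS2 x"
  shows "dir_deriv (\<lambda>y. christoffel (TxS2 x) (chart_metric round_metric x) y v w) 0 u
    = (- 1 / 2) *\<^sub>R ((u \<bullet> v) *\<^sub>R w + (u \<bullet> w) *\<^sub>R v - (v \<bullet> w) *\<^sub>R u)"
proof -
  have "t *\<^sub>R u \<in> TxS2 x" for t
    using assms by (simp add: TxS2_def)
  then have "(\<lambda>t. christoffel (TxS2 x) (chart_metric round_metric x) (0 + t *\<^sub>R u) v w)
      = (\<lambda>t. (- 2 * t / (4 + t\<^sup>2 * (u \<bullet> u))) *\<^sub>R ((u \<bullet> v) *\<^sub>R w + (u \<bullet> w) *\<^sub>R v - (v \<bullet> w) *\<^sub>R u))"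
    using assms
    by (simp add: christoffel_round round_christoffel_def power2_eq_square algebra_simps)
  moreover have "((\<lambda>t. (- 2 * t / (4 + t\<^sup>2 * (u \<bullet> u))) *\<^sub>R X) has_vector_derivative (- 1 / 2) *\<^sub>R X) (at 0)"
    for X :: "real^3"
  proof -
    have "((\<lambda>t. - 2 * t / (4 + t\<^sup>2 * (u \<bullet> u))) has_real_derivative (- 1 / 2)) (at 0)"
      by (auto intro!: derivative_eq_intros)
    then show ?thesis
      by (auto intro!: derivative_eq_intros)
  qed
  ultimately show ?thesis
    unfolding dir_deriv_def by (simp only: vector_derivative_at)
qed

text \<open>The Christoffel symbols vanish at the centre of the chart, so only their first
  derivatives contribute.\<close>

lemma riemann_tensor_round:
  assumes "x \<in> S2" "u \<in> TxS2 x" "v \<in> TxS2 x"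
  shows "riemann_tensor (TxS2 x) (chart_metric round_metric x) 0 u v v = (v \<bullet> v) *\<^sub>R u - (u \<bullet> v) *\<^sub>R v"
proof -
  have 0: "0 \<in> TxS2 x" by (simp add: TxS2_def)
  have z: "christoffel (TxS2 x) (chart_metric round_metric x) 0 a b = 0"
    if "a \<in> TxS2 x" "b \<in> TxS2 x" for a b
    using that assms 0 by (simp add: christoffel_round round_christoffel_def)
  have "(- 1 / 2) *\<^sub>R (a + a - b) + (1 / 2) *\<^sub>R b = b - a" for a b :: "real^3"
    by (simp add: vec_eq_iff field_simps)
  then show ?thesis
    unfolding riemann_tensor_def Let_def using assms 0
    by (simp add: z dir_deriv_round_christoffel inner_commute) (simp add: vec_eq_iff field_simps)
qed

lemma gauss_curvature_round:
  assumes "x \<in> S2"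
  shows "gauss_curvature round_metric x = 1"
  unfolding gauss_curvature_def
proof (rule the_equality)
  show R: "\<forall>u\<in>TxS2 x. \<forall>v\<in>TxS2 x. 
     round_metric x (riemann_tensor (TxS2 x) (chart_metric round_metric x) 0 u v v) u
       = 1 * (round_metric x u u * round_metric x v v - (round_metric x u v)\<^sup>2)"
    using assms
    by (auto simp: riemann_tensor_round round_metric_def inner_diff_left power2_eq_square
        intro: inner_commute)
  fix k assume k: "\<forall>u\<in>TxS2 x. \<forall>v\<in>TxS2 x. 
     round_metric x (riemann_tensor (TxS2 x) (chart_metric round_metric x) 0 u v v) u
       = k * (round_metric x u u * round_metric x v v - (round_metric x u v)\<^sup>2)"
  have x: "x \<bullet> x = 1"
    using assms by (simp add: dot_square_norm)
  \<comment> \<open>Uniqueness of the curvature takes one tangent pair of nonzero area. Some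
    coordinate vector has a nonzero cross product with \<open>x\<close>, and that product is
    tangent.\<close>
  obtain v where v: "v \<noteq> 0" "x \<bullet> v = 0"
    using cross_basis_nonzero[of x] x dot_cross_self(1)[of x] by force
  let ?n = "x \<times> v"
  have n: "?n \<in> TxS2 x" "v \<in> TxS2 x" "v \<bullet> ?n = 0" "?n \<bullet> ?n = v \<bullet> v"
    using v x by (auto simp: TxS2_def dot_cross_self dot_cross inner_commute)
  have "k * ((v \<bullet> v) * (v \<bullet> v)) = (v \<bullet> v) * (v \<bullet> v)"
    using bspec[OF bspec[OF k n(2)] n(1)] bspec[OF bspec[OF R n(2)] n(1)] n
    by (simp add: round_metric_def)
  then show "k = 1"
    using v by simp
qed

section \<open>A zonal magnetic field\<close>

text \<open>This is \<open>1 + c (3 z^2 - 1)\<close> with \<open>c = 5/6\<close>. For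
  \<open>0 < c < 1\<close> the function is positive and the contact estimate below works; at the
  point chosen below the magnetic curvature is \<open>2 - 14/5 c\<close>, negative for
  \<open>c > 5/7\<close>.\<close>

definition zonal :: "real^3 \<Rightarrow> real" where
  "zonal x = 1/6 + 5/2 * (x $ 3)\<^sup>2"

lemma zonal_pos: "0 < zonal x"
  by (simp add: zonal_def add_pos_nonneg)

lemma smooth_on_zonal: "smooth_on UNIV zonal"
proof -
  have "smooth_on UNIV (\<lambda>x::real^3. 1/6 + 5/2 * (x $ 3 * x $ 3))"
    by (intro smooth_on_add smooth_on_bilinear[OF bounded_bilinear_mult]
        smooth_on_const smooth_on_bounded_linear bounded_linear_vec_nth)
  then show ?thesis
    by (simp add: zonal_def[abs_def] power2_eq_square)
qed

lemma zonal_has_derivative: "(zonal has_derivative (\<lambda>w. 5 * x $ 3 * w $ 3)) (at x within S)"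
  unfolding zonal_def[abs_def]
  by (auto intro!: derivative_eq_intros bounded_linear_imp_has_derivative[OF bounded_linear_vec_nth])

text \<open>A derivative within the sphere is not unique in the normal direction, so
  \<open>frechet_derivative\<close> is some unknown choice. Composing with the great circle of
  velocity \<open>w\<close> shows that all choices agree on \<open>w\<close>.\<close>

lemma zonal_frechet_derivative:
  assumes "x \<in> S2" "w \<in> TxS2 x" "w \<bullet> w = 1"
  shows "frechet_derivative zonal (at x within S2) w = 5 * x $ 3 * w $ 3"
proof -
  define \<gamma> where "\<gamma> t = cos t *\<^sub>R x + sin t *\<^sub>R w" for t :: real
  have "\<gamma> t \<bullet> \<gamma> t = 1" for t
  proof -
    have "x \<bullet> x = 1" "x \<bullet> w = 0" "w \<bullet> x = 0"
      using assms by (auto simp: TxS2_def dot_square_norm inner_commute)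
    then show ?thesis
      using assms(3) by (simp add: \<gamma>_def inner_add_left inner_add_right)
  qed
  then have \<gamma>S: "range \<gamma> \<subseteq> S2"
    by (auto simp: norm_eq_sqrt_inner)
  have \<gamma>: "(\<gamma> has_derivative (\<lambda>t. t *\<^sub>R w)) (at 0)"
    unfolding \<gamma>_def by (auto intro!: derivative_eq_intros)
  have \<gamma>0: "\<gamma> 0 = x" by (simp add: \<gamma>_def)
  have *: "((\<lambda>t. zonal (\<gamma> t)) has_derivative (\<lambda>t. D (t *\<^sub>R w))) (at 0)"
    if "(zonal has_derivative D) (at x within S2)" for D
    by (rule has_derivative_in_compose[OF \<gamma>]) 
      (use that \<gamma>S \<gamma>0 in \<open>auto intro: has_derivative_subset\<close>)
  have "(zonal has_derivative frechet_derivative zonal (at x within S2)) (at x within S2)"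
    using zonal_has_derivative frechet_derivative_works differentiable_def by blast
  from has_derivative_unique[OF *[OF this] *[OF zonal_has_derivative]]
  show ?thesis by (auto dest: fun_cong[of _ _ 1])
qed

section \<open>The total flux of the field\<close>

lemma spherical_has_derivative:
  "(spherical has_derivative (\<lambda>(s, t). s *\<^sub>R vector [cos a * cos b, cos a * sin b, - sin a]
      + t *\<^sub>R vector [- sin a * sin b, sin a * cos b, 0])) (at (a, b))"
proof -
  have e: "spherical = (\<lambda>q. (sin (fst q) * cos (snd q)) *\<^sub>R axis 1 1
      + (sin (fst q) * sin (snd q)) *\<^sub>R axis 2 1 + cos (fst q) *\<^sub>R axis 3 1)"
    by (auto simp: spherical_def fun_eq_iff vec_eq_iff forall_3 axis_def)
  show ?thesis
    unfolding e
    by (auto intro!: derivative_eq_intros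
        simp: fun_eq_iff vec_eq_iff forall_3 axis_def algebra_simps)
qed

text \<open>In spherical coordinates the area form is \<open>sin a da db\<close>. What remains is
  \<open>2 * pi\<close> times an integral in \<open>cos a\<close>, solved by an antiderivative cubic
  in \<open>cos a\<close>.\<close>

lemma integral_zonal: "integral_S2 (magnetic_form round_metric zonal) = 4 * pi"
proof -
  let ?h = "\<lambda>a. (1/6 + 5/2 * (cos a)\<^sup>2) * sin a"
  have "magnetic_form round_metric zonal (spherical q) (frechet_derivative spherical (at q) (1, 0))
      (frechet_derivative spherical (at q) (0, 1)) = ?h (fst q)" if q: "q \<in> cbox (0, 0) (pi, 2 * pi)" for q
  proof (cases q)
    case (Pair a b)
    have D: "frechet_derivative spherical (at (a, b)) = (\<lambda>(s, t). s *\<^sub>R vector [cos a * cos b, cos a * sin b, - sin a]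
      + t *\<^sub>R vector [- sin a * sin b, sin a * cos b, 0])"
      using frechet_derivative_at[OF spherical_has_derivative] by simp
    have ab: "(sin b)\<^sup>2 + (cos b)\<^sup>2 = 1" "(sin a)\<^sup>2 + (cos a)\<^sup>2 = 1" by simp_all
    \<comment> \<open>The Pythagorean rules are switched off so that this is a polynomial identity;
      they collapse the displayed factors afterwards. The next products are treated the same
      way.\<close>
    have "spherical (a, b) \<bullet> spherical (a, b) = (sin a)\<^sup>2 * ((sin b)\<^sup>2 + (cos b)\<^sup>2) + (cos a)\<^sup>2"
      by (simp add: spherical_def inner_vec_def sum_3 power2_eq_square algebra_simps
          del: sin_cos_squared_add sin_cos_squared_add2 sin_cos_squared_add3)
    then have S: "spherical (a, b) \<in> S2"
      by (simp add: norm_eq_sqrt_inner)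
    have "spherical (a, b) \<bullet> vector [cos a * cos b, cos a * sin b, - sin a] =
        sin a * cos a * ((sin b)\<^sup>2 + (cos b)\<^sup>2 - 1)"
      by (simp add: spherical_def inner_vec_def sum_3 power2_eq_square algebra_simps
          del: sin_cos_squared_add sin_cos_squared_add2 sin_cos_squared_add3)
    then have u: "vector [cos a * cos b, cos a * sin b, - sin a] \<in> TxS2 (spherical (a, b))"
      by (simp add: TxS2_def)
    have w: "vector [- sin a * sin b, sin a * cos b, 0] \<in> TxS2 (spherical (a, b))"
      by (simp add: TxS2_def spherical_def inner_vec_def sum_3)
    have "spherical (a, b) \<bullet> (vector [cos a * cos b, cos a * sin b, - sin a] \<times>
        vector [- sin a * sin b, sin a * cos b, 0])
      = sin a * ((sin a)\<^sup>2 + (cos a)\<^sup>2) * ((sin b)\<^sup>2 + (cos b)\<^sup>2)"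
      by (simp add: spherical_def inner_vec_def sum_3 cross3_def power2_eq_square algebra_simps
          del: sin_cos_squared_add sin_cos_squared_add2 sin_cos_squared_add3)
    then show ?thesis
      using S u w unfolding Pair
      by (simp add: magnetic_form_def D area_form_round) (simp add: zonal_def spherical_def)
  qed
  then have "integral_S2 (magnetic_form round_metric zonal)
      = integral (cbox (0, 0) (pi, 2 * pi)) (\<lambda>q. ?h (fst q))"
    unfolding integral_S2_def by (rule integral_cong)
  also have "\<dots> = integral (cbox 0 pi) (\<lambda>a. integral (cbox 0 (2 * pi)) (\<lambda>b. ?h a))"
    by (subst integral_prod_continuous) (auto intro!: continuous_intros)
  also have "\<dots> = integral (cbox 0 pi) (\<lambda>a. 2 * pi * ?h a)"
    by (intro integral_cong) simp
  also have "\<dots> = 4 * pi"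
  proof -
    have "((\<lambda>a. 2 * pi * ?h a) has_integral
      2 * pi * (- cos pi / 6 - 5/6 * cos pi ^ 3) - 2 * pi * (- cos 0 / 6 - 5/6 * cos 0 ^ 3)) {0..pi}"
      by (rule fundamental_theorem_of_calculus)
        (auto intro!: derivative_eq_intros simp: has_real_derivative_iff_has_vector_derivative[symmetric]
          power2_eq_square algebra_simps)
    then have "((\<lambda>a. 2 * pi * ?h a) has_integral 4 * pi) (cbox 0 pi)"
      by simp
    then show ?thesis
      by (rule integral_unique)
  qed
  finally show ?thesis .
qed

section \<open>A point of negative magnetic curvature\<close>

lemma magnetic_curvature_not_pos:
  "\<exists>(x, v)\<in>unit_tangent_bundle round_metric. \<not> 0 < magnetic_curvature round_metric zonal 1 x v"
proof -
  \<comment> \<open>A rational point at middle latitude, where \<open>zonal\<close> is steep. As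
    \<open>v\<close> points east, \<open>x \<times> v\<close> points north, the direction in which
    \<open>zonal\<close> grows.\<close>
  define x :: "real^3" where "x = vector [4/5, 0, 3/5]"
  define v :: "real^3" where "v = vector [0, 1, 0]"
  have "x \<bullet> x = 1"
    by (simp add: x_def inner_vec_def sum_3)
  then have x: "x \<in> S2"
    by (simp add: norm_eq_sqrt_inner)
  have v: "v \<in> TxS2 x" "v \<bullet> v = 1"
    by (simp_all add: x_def v_def TxS2_def inner_vec_def sum_3)
  have xv: "x \<times> v = vector [- 3/5, 0, 4/5]"
    by (simp add: x_def v_def cross3_def vec_eq_iff forall_3)
  then have n: "x \<times> v \<in> TxS2 x" "(x \<times> v) \<bullet> (x \<times> v) = 1"
    by (simp_all add: TxS2_def x_def inner_vec_def sum_3)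
  have "magnetic_curvature round_metric zonal 1 x v = - 1 / 3"
    using x v n
    by (simp add: magnetic_curvature_def gauss_curvature_round rot_round zonal_frechet_derivative)
      (simp add: xv, simp add: x_def zonal_def power2_eq_square)
  moreover have "(x, v) \<in> unit_tangent_bundle round_metric"
    using x v by (simp add: unit_tangent_bundle_def TS2_def round_metric_def)
  ultimately show ?thesis
    by (intro bexI[of _ "(x, v)"]) auto
qed

section \<open>A contact primitive\<close>

lemma energy_level_round:
  "(x, v) \<in> energy_level round_metric (1/2) \<longleftrightarrow> x \<in> S2 \<and> v \<in> TxS2 x \<and> v \<bullet> v = 1"
  by (auto simp: energy_level_def TS2_def round_metric_def)

text \<open>These are the differentials of the three equations \<open>x \<bullet> x = 1\<close>,
  \<open>x \<bullet> v = 0\<close> and \<open>v \<bullet> v = 1\<close> that cut out the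
  level.\<close>

lemma tangent_energy_level_round:
  assumes "(a, b) \<in> tangent_space (energy_level round_metric (1/2)) (x, v)"
  shows "a \<in> TxS2 x" "a \<bullet> v + x \<bullet> b = 0" "v \<bullet> b = 0"
proof -
  have d: "((\<lambda>z::(real^3) \<times> (real^3). fst z \<bullet> fst z) has_derivative (\<lambda>\<eta>. 2 * (x \<bullet> fst \<eta>))) (at (x, v))"
    "((\<lambda>z::(real^3) \<times> (real^3). fst z \<bullet> snd z) has_derivative (\<lambda>\<eta>. fst \<eta> \<bullet> v + x \<bullet> snd \<eta>)) (at (x, v))"
    "((\<lambda>z::(real^3) \<times> (real^3). snd z \<bullet> snd z) has_derivative (\<lambda>\<eta>. 2 * (v \<bullet> snd \<eta>))) (at (x, v))"
    by (auto intro!: derivative_eq_intros simp: inner_commute)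
  show "a \<in> TxS2 x"
    using tangent_space_constraint[OF assms d(1), of 1]
    by (auto simp: energy_level_def TS2_def TxS2_def dot_square_norm)
  show "a \<bullet> v + x \<bullet> b = 0"
    using tangent_space_constraint[OF assms d(2), of 0]
    by (auto simp: energy_level_def TS2_def TxS2_def)
  show "v \<bullet> b = 0"
    using tangent_space_constraint[OF assms d(3), of 1]
    by (auto simp: energy_level_def round_metric_def)
qed

text \<open>The geodesic, the orthogonal horizontal and the vertical field. Their curves are the
  geodesic flow, parallel transport of \<open>v\<close> along the great circle orthogonal to it, and
  rotation of the fibre.\<close>

lemma energy_level_round_tangents:
  assumes "(x, v) \<in> energy_level round_metric (1/2)"
  defines "T \<equiv> tangent_space (energy_level round_metric (1/2)) (x, v)"
  shows "(v, - x) \<in> T" "(x \<times> v, 0) \<in> T" "(0, x \<times> v) \<in> T"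
proof -
  have x: "x \<bullet> x = 1" and xv: "x \<bullet> v = 0" "v \<bullet> x = 0" and vv: "v \<bullet> v = 1"
    using assms(1) by (auto simp: energy_level_round TxS2_def dot_square_norm inner_commute)
  have nn: "(x \<times> v) \<bullet> (x \<times> v) = 1"
    using x xv vv by (simp add: dot_cross)
  have level: "p \<in> energy_level round_metric (1/2)"
    if "fst p \<bullet> fst p = 1" "fst p \<bullet> snd p = 0" "snd p \<bullet> snd p = 1" for p
    using that by (cases p) (simp add: energy_level_round TxS2_def norm_eq_sqrt_inner)
  note s = inner_add_left inner_add_right inner_diff_left inner_diff_right x xv vv nn dot_cross_self
  have "cos t *\<^sub>R (x, v) + sin t *\<^sub>R (v, - x) + 0 \<in> energy_level round_metric (1/2)" for t
    by (rule level) (simp_all add: s)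
  from trig_curve_tangent[OF this] show "(v, - x) \<in> T"
    by (simp add: T_def)
  have "cos t *\<^sub>R (x, 0) + sin t *\<^sub>R (x \<times> v, 0) + (0, v) \<in> energy_level round_metric (1/2)" for t
    by (rule level) (simp_all add: s)
  from trig_curve_tangent[OF this] show "(x \<times> v, 0) \<in> T"
    by (simp add: T_def)
  have "cos t *\<^sub>R (0, v) + sin t *\<^sub>R (0, x \<times> v) + (x, 0) \<in> energy_level round_metric (1/2)" for t
    by (rule level) (simp_all add: s)
  from trig_curve_tangent[OF this] show "(0, x \<times> v) \<in> T"
    by (simp add: T_def)
qed

text \<open>The three summands are the Liouville form, a connection form \<open>\<psi>\<close> with \<open>d\<psi> = - \<mu>\<close>, and the pullback
  of a one-form \<open>\<beta>\<close> on the sphere with \<open>d\<beta> = (1 - f) \<mu>\<close>.\<close>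
definition primitive :: "(real^3) \<times> (real^3) \<Rightarrow> (real^3) \<times> (real^3) \<Rightarrow> real" where
  "primitive z \<xi> = snd z \<bullet> fst \<xi> + (fst z \<times> snd z) \<bullet> snd \<xi>
     + (- 5/6) * (fst z $ 3 * (fst z $ 1 * fst \<xi> $ 2 + - (fst z $ 2) * fst \<xi> $ 1))"

lemma smooth_one_form_liouville: "smooth_one_form UNIV (liouville_form round_metric)"
  unfolding smooth_one_form_def liouville_form_def round_metric_def case_prod_beta
  by (intro conjI ballI allI linearI smooth_on_bilinear[OF bounded_bilinear_inner]
      smooth_on_const smooth_on_bounded_linear[OF bounded_linear_snd])
    (simp_all add: inner_add_right)

lemma smooth_one_form_primitive: "smooth_one_form UNIV primitive"
proof -
  have comp: "bounded_linear (\<lambda>z::(real^3) \<times> (real^3). fst z $ i)" for i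
    by (intro bounded_linear_compose[OF bounded_linear_vec_nth] bounded_linear_intros)
  have "linear (primitive z)" for z
    by (rule linearI) (simp_all add: primitive_def inner_add_right algebra_simps)
  moreover have "smooth_on UNIV (\<lambda>z. primitive z \<xi>)" for \<xi>
    unfolding primitive_def
    \<comment> \<open>\<open>primitive\<close> is written with \<open>+ (- 5/6) *\<close> and
      \<open>+ -\<close> in place of differences, so that the rules for sums, products and linear
      maps take it apart.\<close>
    by (intro smooth_on_add smooth_on_bilinear[OF bounded_bilinear_mult]
        smooth_on_bilinear[OF bounded_bilinear_inner]
        smooth_on_bilinear[OF bounded_bilinear_cross3] smooth_on_const
        smooth_on_bounded_linear bounded_linear_minus comp bounded_linear_fst bounded_linear_snd)
  ultimately show ?thesis
    by (simp add: smooth_one_form_def)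
qed

lemma exterior_derivative_liouville:
  "exterior_derivative (liouville_form round_metric) z \<xi> \<eta> = snd \<xi> \<bullet> fst \<eta> - snd \<eta> \<bullet> fst \<xi>"
  by (rule exterior_derivative_eqI[where D="\<lambda>w \<zeta>. snd \<zeta> \<bullet> fst w"])
    (auto simp: liouville_form_def round_metric_def case_prod_beta intro!: derivative_eq_intros)

text \<open>Computed in the ambient space for arbitrary vectors. The summands are, in order, the
  differentials of the Liouville form, of \<open>\<psi>\<close> and of
  \<open>\<beta>\<close>.\<close>

lemma exterior_derivative_primitive:
  "exterior_derivative primitive (x, v) (a, b) (a', b') =
     b \<bullet> a' - b' \<bullet> a
     + ((a \<times> v) \<bullet> b' - (a' \<times> v) \<bullet> b + 2 * ((x \<times> b) \<bullet> b'))
     - 5/6 * (a $ 3 * (x $ 1 * a' $ 2 - x $ 2 * a' $ 1) - a' $ 3 * (x $ 1 * a $ 2 - x $ 2 * a $ 1)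
         + 2 * (x $ 3 * (a \<times> a') $ 3))"
proof -
  have comp: "((\<lambda>z::(real^3) \<times> (real^3). fst z $ i) has_derivative (\<lambda>\<zeta>. fst \<zeta> $ i)) F" for i F
    by (intro bounded_linear_imp_has_derivative bounded_linear_compose[OF bounded_linear_vec_nth]
        bounded_linear_intros)
  have "((\<lambda>y. primitive y w) has_derivative (\<lambda>\<zeta>. snd \<zeta> \<bullet> fst w
      + (fst \<zeta> \<times> v + x \<times> snd \<zeta>) \<bullet> snd w
      - 5/6 * (fst \<zeta> $ 3 * (x $ 1 * fst w $ 2 - x $ 2 * fst w $ 1)
         + x $ 3 * (fst \<zeta> $ 1 * fst w $ 2 - fst \<zeta> $ 2 * fst w $ 1)))) (at (x, v))" for w
    unfolding primitive_def
    by (auto intro!: derivative_eq_intros comp bounded_bilinear.FDERIV[OF bounded_bilinear_cross3]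
        simp: fun_eq_iff field_simps inner_add_left)
  from exterior_derivative_eqI[of primitive, OF this, of "(a, b)" "(a', b')"]
  have "exterior_derivative primitive (x, v) (a, b) (a', b') =
     b \<bullet> a' - b' \<bullet> a + ((a \<times> v + x \<times> b) \<bullet> b' - (a' \<times> v + x \<times> b') \<bullet> b)
     - 5/6 * (a $ 3 * (x $ 1 * a' $ 2 - x $ 2 * a' $ 1) - a' $ 3 * (x $ 1 * a $ 2 - x $ 2 * a $ 1)
         + x $ 3 * (a $ 1 * a' $ 2 - a $ 2 * a' $ 1) - x $ 3 * (a' $ 1 * a $ 2 - a' $ 2 * a $ 1))"
    by (simp add: algebra_simps)
  \<comment> \<open>Antisymmetry merges the two terms from differentiating \<open>v\<close> in
    \<open>\<psi>\<close>, whence the factor \<open>2\<close>.\<close>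
  moreover have "(x \<times> b') \<bullet> b = - ((x \<times> b) \<bullet> b')"
    by (simp add: cross3_simps)
  ultimately show ?thesis
    by (simp add: inner_add_left cross_components algebra_simps)
qed

lemma exterior_derivative_primitive_tangent:
  assumes p: "(x, v) \<in> energy_level round_metric (1/2)"
    and t: "(a, b) \<in> tangent_space (energy_level round_metric (1/2)) (x, v)"
    and t': "(a', b') \<in> tangent_space (energy_level round_metric (1/2)) (x, v)"
  shows "exterior_derivative primitive (x, v) (a, b) (a', b')
    = b \<bullet> a' - b' \<bullet> a - magnetic_form round_metric zonal x a a'"
proof -
  have S: "x \<in> S2" and x: "x \<bullet> x = 1" and v: "v \<in> TxS2 x" "v \<bullet> v = 1" and xv: "x \<bullet> v = 0" "v \<bullet> x = 0"
    using p by (auto simp: energy_level_round TxS2_def dot_square_norm inner_commute)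
  let ?n = "x \<times> v"
  have nn: "?n \<bullet> ?n = 1"
    using x xv v by (simp add: dot_cross)
  note a = tangent_energy_level_round[OF t] and a' = tangent_energy_level_round[OF t']
  have fr: "d = (x \<bullet> d) *\<^sub>R x + (d \<bullet> v) *\<^sub>R v + (d \<bullet> ?n) *\<^sub>R ?n" for d
  proof -
    have "d - (x \<bullet> d) *\<^sub>R x \<in> TxS2 x"
      using x by (simp add: TxS2_def inner_diff_right)
    from tangent_frame[OF S v this] show ?thesis
      using xv by (simp add: inner_diff_left dot_cross_self algebra_simps)
  qed
  \<comment> \<open>The tangency conditions give \<open>(a, b) = p (v, - x) + q (n, 0) + r (0, n)\<close> with \<open>n = x \<times> v\<close>.\<close>
  define p q p' q' where "p = a \<bullet> v" "q = a \<bullet> ?n" "p' = a' \<bullet> v" "q' = a' \<bullet> ?n"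
  note pq = this
  have ea: "a = p *\<^sub>R v + q *\<^sub>R ?n" and ea': "a' = p' *\<^sub>R v + q' *\<^sub>R ?n"
    using tangent_frame[OF S v] a(1) a'(1) pq by auto
  have eb: "\<exists>r. b = r *\<^sub>R ?n - p *\<^sub>R x" if "a \<bullet> v + x \<bullet> b = 0" "v \<bullet> b = 0" "p = a \<bullet> v" for a b p
  proof -
    have *: "x \<bullet> b = - p" "b \<bullet> v = 0"
      using that by (simp_all add: inner_commute)
    have "b = (b \<bullet> ?n) *\<^sub>R ?n - p *\<^sub>R x"
      by (rule trans[OF fr[of b]]) (simp add: *)
    then show ?thesis by blast
  qed
  obtain r r' where eb: "b = r *\<^sub>R ?n - p *\<^sub>R x" and eb': "b' = r' *\<^sub>R ?n - p' *\<^sub>R x"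
    using eb[OF a(2,3) pq(1)] eb[OF a'(2,3) pq(3)] by blast
  have c: "v \<times> ?n = x" "?n \<times> v = - x" "x \<times> ?n = - v" "?n \<times> x = v" "v \<times> x = - ?n"
    using x v xv by (simp_all add: Lagrange cross_skew[of ?n] cross_skew[of v x])
  \<comment> \<open>The structure equation \<open>d\<psi> = - K \<mu>\<close> with
    \<open>K = 1\<close>: in the frame both sides are \<open>q p' - p q'\<close>.\<close>
  have "(a \<times> v) \<bullet> b' - (a' \<times> v) \<bullet> b + 2 * ((x \<times> b) \<bullet> b') = - (x \<bullet> (a \<times> a'))"
    unfolding ea ea' eb eb'
    by (simp add: Cross3.right_diff_distrib cross_add_left cross_add_right cross_mult_left
        cross_mult_right c inner_diff_left inner_diff_right inner_add_left inner_add_right x xv v nn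
        dot_cross_self algebra_simps)
  \<comment> \<open>The differential of \<open>\<beta>\<close>. Since \<open>a \<times> a'\<close>
    is a multiple of \<open>x\<close>, everything reduces to squares of the coordinates of
    \<open>x\<close>, and \<open>5/6 (3 z^2 - 1)\<close> is \<open>zonal x - 1\<close>.\<close>
  moreover have "a $ 3 * (x $ 1 * a' $ 2 - x $ 2 * a' $ 1) - a' $ 3 * (x $ 1 * a $ 2 - x $ 2 * a $ 1)
         + 2 * (x $ 3 * (a \<times> a') $ 3) = (x \<bullet> (a \<times> a')) * (3 * (x $ 3)\<^sup>2 - 1)"
  proof -
    define D where "D = x \<bullet> (a \<times> a')"
    have "(a \<times> a') $ i = D * x $ i" for i
      using cross3_tangent[OF S a(1) a'(1)] by (metis D_def vector_scaleR_component real_scaleR_def)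
    note comp = this[of 1] this[of 2] this[of 3]
    have "a $ 3 * (x $ 1 * a' $ 2 - x $ 2 * a' $ 1) - a' $ 3 * (x $ 1 * a $ 2 - x $ 2 * a $ 1)
         = - x $ 1 * (a \<times> a') $ 1 - x $ 2 * (a \<times> a') $ 2"
      by (simp add: cross_components algebra_simps)
    moreover have "x $ 1 * x $ 1 + x $ 2 * x $ 2 + x $ 3 * x $ 3 = 1"
      using x by (simp add: inner_vec_def sum_3)
    then have "D * (x $ 1 * x $ 1 + x $ 2 * x $ 2 + x $ 3 * x $ 3) = D" by simp
    ultimately show ?thesis
      unfolding comp D_def[symmetric] by (simp add: power2_eq_square algebra_simps)
  qed
  moreover have "magnetic_form round_metric zonal x a a' = zonal x * (x \<bullet> (a \<times> a'))"
    using S a(1) a'(1) by (simp add: magnetic_form_def area_form_round)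
  ultimately show ?thesis
    unfolding exterior_derivative_primitive by (simp add: zonal_def algebra_simps)
qed

lemma contact_type_zonal: "contact_type round_metric (magnetic_form round_metric zonal) (1/2)"
proof -
  let ?\<Sigma> = "energy_level round_metric (1/2)"
  let ?d\<alpha> = "exterior_derivative (liouville_form round_metric)"
  let ?\<omega> = "\<lambda>z \<xi> \<eta>. ?d\<alpha> z \<xi> \<eta> - magnetic_form round_metric zonal (fst z) (fst \<xi>) (fst \<eta>)"
  have \<alpha>: "has_exterior_derivative_on TS2 (liouville_form round_metric) ?d\<alpha>"
    by (intro has_exterior_derivative_on_global smooth_one_form_liouville refl)
  have \<omega>: "has_exterior_derivative_on ?\<Sigma> primitive ?\<omega>"
    by (rule has_exterior_derivative_on_global[OF smooth_one_form_primitive])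
      (auto simp: exterior_derivative_primitive_tangent exterior_derivative_liouville)
  have "\<exists>a\<in>tangent_space ?\<Sigma> p. \<exists>b\<in>tangent_space ?\<Sigma> p. \<exists>c\<in>tangent_space ?\<Sigma> p.
      primitive p a * ?\<omega> p b c + primitive p b * ?\<omega> p c a + primitive p c * ?\<omega> p a b \<noteq> 0"
    if p: "p \<in> ?\<Sigma>" for p
  proof -
    obtain x v where xv: "p = (x, v)" by force
    have S: "x \<in> S2" and x: "x \<bullet> x = 1" and v: "v \<in> TxS2 x" "v \<bullet> v = 1" and 0: "x \<bullet> v = 0" "v \<bullet> x = 0"
      using p xv by (auto simp: energy_level_round TxS2_def dot_square_norm inner_commute)
    let ?n = "x \<times> v"
    have nn: "?n \<bullet> ?n = 1"
      using x 0 v by (simp add: dot_cross)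
    \<comment> \<open>\<open>\<beta>(v)\<close> is \<open>- 5/6 * B\<close>. The bracket is the
      third coordinate of \<open>x \<times> v\<close>, so \<open>B\<close> is a product of
      coordinates of two unit vectors.\<close>
    define B where "B = x $ 3 * (x $ 1 * v $ 2 - x $ 2 * v $ 1)"
    have "\<bar>x $ 3\<bar> \<le> 1" "\<bar>?n $ 3\<bar> \<le> 1"
      using component_le_norm_cart[of x 3] component_le_norm_cart[of ?n 3] x nn
      by (simp_all add: norm_eq_sqrt_inner)
    then have "\<bar>B\<bar> \<le> 1"
      using mult_mono[of "\<bar>x $ 3\<bar>" 1 "\<bar>?n $ 3\<bar>" 1]
      by (simp add: B_def cross_components abs_mult mult.commute)
    have area: "x \<bullet> (v \<times> ?n) = 1"
      using 0 x v by (simp add: Lagrange)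
    have n: "?n \<in> TxS2 x" by (simp add: TxS2_def dot_cross_self)
    have z: "area_form round_metric x 0 u = 0" "area_form round_metric x u 0 = 0" for u
      by (simp_all add: area_form_def)
    \<comment> \<open>The first summand pairs the horizontal and vertical normals under
      \<open>d\<alpha>\<close>, with value \<open>- 1\<close>; the second vanishes; the third
      carries the magnetic term. Both surviving contributions are negative, so they cannot
      cancel.\<close>
    have "primitive p (v, - x) * ?\<omega> p (?n, 0) (0, ?n) + primitive p (?n, 0) * ?\<omega> p (0, ?n) (v, - x)
        + primitive p (0, ?n) * ?\<omega> p (v, - x) (?n, 0) = - (1 - 5/6 * B) - zonal x"
      using S v n unfolding xv
      by (simp add: exterior_derivative_liouville magnetic_form_def z area_form_round area)
        (simp add: primitive_def B_def v nn dot_cross_self)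
    moreover have "1 - 5/6 * B > 0"
      using \<open>\<bar>B\<bar> \<le> 1\<close> by linarith
    ultimately have "primitive p (v, - x) * ?\<omega> p (?n, 0) (0, ?n)
        + primitive p (?n, 0) * ?\<omega> p (0, ?n) (v, - x)
        + primitive p (0, ?n) * ?\<omega> p (v, - x) (?n, 0) \<noteq> 0"
      using zonal_pos[of x] by linarith
    then show ?thesis
      using energy_level_round_tangents[of x v] p xv by blast
  qed
  with \<omega> have "contact_form_on ?\<Sigma> primitive"
    unfolding contact_form_on_def by blast
  with \<alpha> \<omega> show ?thesis
    unfolding contact_type_def by blast
qed

theorem proposition4p8:
  shows "\<exists>(g :: metric) (f :: real^3 \<Rightarrow> real) (m :: real).
     riemannian_metric g \<and>
     smooth_map_on S2 f \<and> (\<forall>x\<in>S2. 0 < f x) \<and>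
     integral_S2 (magnetic_form g f) = 4 * pi \<and>
     0 < m \<and>
     contact_type g (magnetic_form g f) (m\<^sup>2 / 2) \<and>
     \<not> (\<forall>(x, v)\<in>unit_tangent_bundle g. 0 < magnetic_curvature g f m x v)"
proof (intro exI conjI)
  show "riemannian_metric round_metric"
    by (rule riemannian_metric_round)
  show "smooth_map_on S2 zonal"
    by (rule smooth_map_on_UNIV[OF smooth_on_zonal])
  show "\<forall>x\<in>S2. 0 < zonal x"
    using zonal_pos by blast
  show "integral_S2 (magnetic_form round_metric zonal) = 4 * pi"
    by (rule integral_zonal)
  show "(0::real) < 1"
    by simp
  show "contact_type round_metric (magnetic_form round_metric zonal) (1\<^sup>2 / 2)"
    using contact_type_zonal by simp
  show "\<not> (\<forall>(x, v)\<in>unit_tangent_bundle round_metric. 0 < magnetic_curvature round_metric zonal 1 x v)"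
    using magnetic_curvature_not_pos by blast
qed

end
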